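(* Let $a,b,c,d\in\mathbb{C}$ with $ad-bc=1$, let $g(z)=\dfrac{az+b}{cz+d}$ be the corresponding Möbius map of $\mathbb{C}_\infty$, and suppose that $g$ is not a chordal isometry. Then $g=S_\chi R_\chi$ (composition, $R_\chi$ applied first), where $R_\chi$ is the reflection across the chordal isometric circle $C_g^\chi$ of $g$, and $S_\chi$ is a chordal isometry.
   Context: $\mathbb{C}_\infty=\mathbb{C}\cup\{\infty\}$ is the Riemann sphere, with the chordal distance $$\chi(z,w)=\frac{2|z-w|}{\sqrt{1+|z|^2}\sqrt{1+|w|^2}},\qquad \chi(z,\infty)=\frac{2}{\sqrt{1+|z|^2}}.$$ A chordal isometry is a (possibly orientation-reversing) isometry of the metric space $(\mathbb{C}_\infty,\chi)$ onto itself; for example $z\mapsto\bar z$ is a chordal isometry. For a Möbius map $g(z)=(az+b)/(cz+d)$ with $ad-bc=1$, the chordal derivative is $g^\chi(z)=\lim_{w\to z}\chi(g(w),g(z))/\chi(w,z)$; explicitly $$g^\chi(z)=\frac{1+|z|^2}{|az+b|^2+|cz+d|^2}\ (z\in\mathbb{C}),\qquad g^\chi(\infty)=\frac{1}{|a|^2+|c|^2}.$$ The chordal isometric circle of $g$ is $C_g^\chi=\{z\in\mathbb{C}_\infty: g^\chi(z)=1\}$. When $g$ is not a chordal isometry, $C_g^\chi$ is either a Euclidean circle or a Euclidean line with $\infty$ attached. The reflection across a Euclidean circle $|z-z_0|=r$ is the inversion $z\mapsto z_0+r^2/(\bar z-\bar z_0)$ (interchanging $z_0$ and $\infty$); the reflection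 across a Euclidean line with $\infty$ attached is the usual Euclidean reflection in the line, fixing $\infty$. *)

theory Defs
  imports "HOL-Analysis.Analysis"
begin

text \<open>The Riemann sphere, as a metric space under the chordal distance.\<close>

datatype riemann_sphere = Fin complex | Infty

fun chordal :: "riemann_sphere \<Rightarrow> riemann_sphere \<Rightarrow> real" where
  "chordal (Fin z) (Fin w) =
     2 * cmod (z - w) / (sqrt (1 + (cmod z)\<^sup>2) * sqrt (1 + (cmod w)\<^sup>2))"
| "chordal (Fin z) Infty = 2 / sqrt (1 + (cmod z)\<^sup>2)"
| "chordal Infty (Fin w) = 2 / sqrt (1 + (cmod w)\<^sup>2)"
| "chordal Infty Infty = 0"

text \<open>The triangle inequality is transported from Euclidean space by stereographic projection.\<close>

fun stereographic :: "riemann_sphere \<Rightarrow> complex \<times> real" where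
  "stereographic (Fin z) =
     ((2 / (1 + (cmod z)\<^sup>2)) *\<^sub>R z, ((cmod z)\<^sup>2 - 1) / (1 + (cmod z)\<^sup>2))"
| "stereographic Infty = (0, 1)"

lemma one_plus_cmod_square_pos: "0 < 1 + (cmod z)\<^sup>2"
  by (simp add: add_pos_nonneg)

lemma chordal_nonneg: "0 \<le> chordal p q"
  by (cases p; cases q) auto

lemma chordal_commute: "chordal p q = chordal q p"
  by (cases p; cases q) (auto simp: norm_minus_commute mult.commute)

lemma chordal_eq_dist_stereographic:
  "chordal p q = dist (stereographic p) (stereographic q)"
proof -
  have fin_inf: "chordal (Fin z) Infty = dist (stereographic (Fin z)) (stereographic Infty)" for z
  proof (rule power2_eq_imp_eq)
    define N where "N = 1 + (cmod z)\<^sup>2"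
    have N: "N > 0" using one_plus_cmod_square_pos by (simp add: N_def)
    have cz: "(cmod z)\<^sup>2 = N - 1" by (simp add: N_def)
    have "(dist (stereographic (Fin z)) (stereographic Infty))\<^sup>2
        = (2 / N)\<^sup>2 * (cmod z)\<^sup>2 + ((N - 2) / N - 1)\<^sup>2"
      by (simp add: dist_norm norm_Pair N_def power_mult_distrib power_divide)
    also have "\<dots> = 4 / N"
      unfolding cz using N by (simp add: field_simps power2_eq_square)
    also have "\<dots> = (chordal (Fin z) Infty)\<^sup>2"
      using N by (simp add: power_divide N_def[symmetric])
    finally show "(chordal (Fin z) Infty)\<^sup>2
        = (dist (stereographic (Fin z)) (stereographic Infty))\<^sup>2" by simp
  qed (simp_all add: chordal_nonneg del: chordal.simps)
  have fin_fin: "chordal (Fin z) (Fin w) = dist (stereographic (Fin z)) (stereographic (Fin w))" for z w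
  proof (rule power2_eq_imp_eq)
    define N M i where "N = 1 + (cmod z)\<^sup>2" and "M = 1 + (cmod w)\<^sup>2" and "i = inner z w"
    have N: "N > 0" "M > 0" using one_plus_cmod_square_pos by (simp_all add: N_def M_def)
    have cz: "(cmod z)\<^sup>2 = N - 1" "(cmod w)\<^sup>2 = M - 1" by (simp_all add: N_def M_def)
    have diff: "(cmod (s *\<^sub>R z - t *\<^sub>R w))\<^sup>2 = s\<^sup>2 * (N - 1) + t\<^sup>2 * (M - 1) - 2 * s * t * i" for s t
      unfolding cz[symmetric] i_def power2_norm_eq_inner
      by (simp add: algebra_simps inner_commute power2_eq_square)
    have "(dist (stereographic (Fin z)) (stereographic (Fin w)))\<^sup>2
        = (cmod ((2 / N) *\<^sub>R z - (2 / M) *\<^sub>R w))\<^sup>2 + ((N - 2) / N - (M - 2) / M)\<^sup>2"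
      by (simp add: dist_norm norm_Pair N_def M_def)
    also have "\<dots> = 4 * (N + M - 2 - 2 * i) / (N * M)"
      unfolding diff using N by (simp add: field_simps power2_eq_square)
    also have "N + M - 2 - 2 * i = (cmod (z - w))\<^sup>2"
      using diff[of 1 1] by simp
    also have "4 * (cmod (z - w))\<^sup>2 / (N * M) = (chordal (Fin z) (Fin w))\<^sup>2"
      using N by (simp add: power_divide power_mult_distrib N_def[symmetric] M_def[symmetric])
    finally show "(chordal (Fin z) (Fin w))\<^sup>2
        = (dist (stereographic (Fin z)) (stereographic (Fin w)))\<^sup>2" by simp
  qed (simp_all add: chordal_nonneg del: chordal.simps)
  show ?thesis
    using fin_inf fin_fin
    by (cases p; cases q) (simp_all add: chordal_commute[of Infty "Fin _"] dist_commute
        del: chordal.simps(1,2,3) stereographic.simps)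
qed

lemma chordal_eq_0_iff: "chordal p q = 0 \<longleftrightarrow> p = q"
  by (cases p; cases q) (auto simp: add_nonneg_eq_0_iff)

instantiation riemann_sphere :: metric_space
begin

definition dist_riemann_sphere :: "riemann_sphere \<Rightarrow> riemann_sphere \<Rightarrow> real" where
  "dist_riemann_sphere = chordal"

definition uniformity_riemann_sphere :: "(riemann_sphere \<times> riemann_sphere) filter" where
  "uniformity_riemann_sphere = (INF e\<in>{0<..}. principal {(p, q). dist p q < e})"

definition open_riemann_sphere :: "riemann_sphere set \<Rightarrow> bool" where
  "open_riemann_sphere U \<longleftrightarrow> (\<forall>p\<in>U. \<forall>\<^sub>F (p', q) in uniformity. p' = p \<longrightarrow> q \<in> U)"

instance
proof
  fix p q s :: riemann_sphere
  show "dist p q = 0 \<longleftrightarrow> p = q"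
    by (simp add: dist_riemann_sphere_def chordal_eq_0_iff)
  show "dist p q \<le> dist p s + dist q s"
    unfolding dist_riemann_sphere_def chordal_eq_dist_stereographic by (rule dist_triangle2)
qed (simp_all add: uniformity_riemann_sphere_def open_riemann_sphere_def)

end

definition chordal_isometry :: "(riemann_sphere \<Rightarrow> riemann_sphere) \<Rightarrow> bool" where
  "chordal_isometry f \<longleftrightarrow> surj f \<and> (\<forall>p q. dist (f p) (f q) = dist p q)"

fun moebius_map :: "complex \<Rightarrow> complex \<Rightarrow> complex \<Rightarrow> complex \<Rightarrow> riemann_sphere \<Rightarrow> riemann_sphere" where
  "moebius_map a b c d (Fin z) = (if c * z + d = 0 then Infty else Fin ((a * z + b) / (c * z + d)))"
| "moebius_map a b c d Infty = (if c = 0 then Infty else Fin (a / c))"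

definition chordal_deriv :: "(riemann_sphere \<Rightarrow> riemann_sphere) \<Rightarrow> riemann_sphere \<Rightarrow> real" where
  "chordal_deriv g p = Lim (at p) (\<lambda>q. dist (g q) (g p) / dist q p)"

definition chordal_isometric_circle ::
    "(riemann_sphere \<Rightarrow> riemann_sphere) \<Rightarrow> riemann_sphere set" where
  "chordal_isometric_circle g = {p. chordal_deriv g p = 1}"

fun circle_inversion :: "complex \<Rightarrow> real \<Rightarrow> riemann_sphere \<Rightarrow> riemann_sphere" where
  "circle_inversion z0 r (Fin z) =
     (if z = z0 then Infty else Fin (z0 + of_real (r\<^sup>2) / (cnj z - cnj z0)))"
| "circle_inversion z0 r Infty = Fin z0"

text \<open>In a reflection across a line, the foot of the perpendicular from a point to the line
  is the midpoint of the point and its image.\<close>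

fun line_reflection :: "complex set \<Rightarrow> riemann_sphere \<Rightarrow> riemann_sphere" where
  "line_reflection L (Fin z) = Fin (2 * closest_point L z - z)"
| "line_reflection L Infty = Infty"

text \<open>A set that is neither a Euclidean circle nor a line with \<open>Infty\<close> attached has no reflection
  across it; otherwise there is exactly one, see \<open>is_reflection_across_unique\<close>.\<close>

definition is_reflection_across ::
    "riemann_sphere set \<Rightarrow> (riemann_sphere \<Rightarrow> riemann_sphere) \<Rightarrow> bool" where
  "is_reflection_across C R \<longleftrightarrow>
     (\<exists>z0 r. 0 < r \<and> C = Fin ` sphere z0 r \<and> R = circle_inversion z0 r) \<or>
     (\<exists>L. affine L \<and> aff_dim L = 1 \<and> C = insert Infty (Fin ` L) \<and> R = line_reflection L)"

lemma is_reflection_across_unique: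
  assumes "is_reflection_across C R" "is_reflection_across C R'"
  shows "R = R'"
proof -
  have inj: "inj Fin" by (simp add: inj_def)
  have centre_radius: "z = w \<and> r = s" if "sphere z r = sphere w s" "0 < r" "0 < s"
    for z w :: complex and r s :: real
  proof -
    have "z = w"
    proof (rule ccontr)
      assume "z \<noteq> w"
      define t where "t = r / cmod (z - w)"
      have t: "t > 0" "t * cmod (z - w) = r" using that \<open>z \<noteq> w\<close> by (auto simp: t_def)
      have "z + t *\<^sub>R (z - w) \<in> sphere z r" "z - t *\<^sub>R (z - w) \<in> sphere z r"
        using t by (simp_all add: dist_norm)
      then have "cmod (z + t *\<^sub>R (z - w) - w) = cmod (z - t *\<^sub>R (z - w) - w)"
        unfolding that(1) by (simp add: dist_norm norm_minus_commute)
      moreover have "z + t *\<^sub>R (z - w) - w = (1 + t) *\<^sub>R (z - w)"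
        "z - t *\<^sub>R (z - w) - w = (1 - t) *\<^sub>R (z - w)" by (simp_all add: algebra_simps)
      ultimately have "\<bar>1 + t\<bar> = \<bar>1 - t\<bar>" using \<open>z \<noteq> w\<close> by simp
      with t(1) show False by linarith
    qed
    moreover have "z + of_real r \<in> sphere w s"
      unfolding that(1)[symmetric] using that(2) by (simp add: dist_norm)
    ultimately show ?thesis using that(2) by (simp add: dist_norm)
  qed
  have line_cancel: "L = L'" if "insert Infty (Fin ` L) = insert Infty (Fin ` L')" for L L'
  proof -
    have "Fin ` L = Fin ` L'" using that by auto
    thus ?thesis by (simp add: inj_image_eq_iff[OF inj])
  qed
  have "Infty \<notin> Fin ` A" for A by auto
  then show ?thesis
    using assms unfolding is_reflection_across_def
    by (metis centre_radius line_cancel inj inj_image_eq_iff insertI1)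
qed

end

theory Submission
  imports Defs
begin

text \<open>On homogeneous coordinates \<open>Z\<close>, the map \<open>g\<close> acts by a matrix \<open>A\<close> of determinant one, and
  its chordal derivative is \<open>|Z|\<^sup>2 / |A Z|\<^sup>2\<close>; so the chordal isometric circle is the null set of
  the Hermitian form \<open>A\<^sup>* A - 1\<close>. The reflection \<open>R\<close> across it acts by \<open>Z \<mapsto> B Z\<^sup>*\<close> (\<open>Z\<^sup>*\<close> the
  conjugate vector) with \<open>B\<close> read off from the polarised form, and \<open>A B\<close> is a multiple of a
  unitary matrix. Hence \<open>g \<circ> R\<close> is a chordal isometry, and \<open>g = (g \<circ> R) \<circ> R\<close>.\<close>

section \<open>Homogeneous coordinates on the Riemann sphere\<close>

definition hom_point :: "complex \<Rightarrow> complex \<Rightarrow> riemann_sphere" where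
  "hom_point x y = (if y = 0 then Infty else Fin (x / y))"

lemma hom_point_cases:
  obtains x y where "p = hom_point x y" "(x, y) \<noteq> 0"
proof (cases p)
  case (Fin z)
  thus ?thesis using that[of z 1] by (simp add: hom_point_def zero_prod_def)
next
  case Infty
  thus ?thesis using that[of 1 0] by (simp add: hom_point_def zero_prod_def)
qed

lemma norm_pair_factor:
  fixes x y :: complex
  assumes "y \<noteq> 0"
  shows "norm (x, y) = cmod y * sqrt (1 + (cmod (x / y))\<^sup>2)"
proof -
  have "(cmod x)\<^sup>2 + (cmod y)\<^sup>2 = (cmod y)\<^sup>2 * (1 + (cmod (x / y))\<^sup>2)"
    using assms by (simp add: field_simps norm_divide)
  thus ?thesis by (simp add: norm_Pair real_sqrt_mult)
qed

text \<open>This form treats infinity like any other point, and a matrix of determinant one leaves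
  the numerator unchanged.\<close>

lemma dist_hom_point:
  assumes "(x, y) \<noteq> 0" "(u, v) \<noteq> 0"
  shows "dist (hom_point x y) (hom_point u v)
    = 2 * cmod (x * v - y * u) / (norm (x, y) * norm (u, v))"
proof -
  have inf: "dist Infty (hom_point u v) = 2 * cmod (x * v) / (norm (x, 0::complex) * norm (u, v))"
    if "x \<noteq> 0" "(u, v) \<noteq> 0" for x u v
    using that norm_pair_factor[of v u]
    by (auto simp: hom_point_def dist_riemann_sphere_def norm_mult norm_Pair)
  show ?thesis
  proof (cases "y = 0 \<or> v = 0")
    case True
    thus ?thesis
      using inf[of x u v] inf[of u x y] assms
      by (auto simp: hom_point_def zero_prod_def dist_commute mult_ac norm_minus_commute)
  next
    case False
    have "cmod (x / y - u / v) = cmod (x * v - y * u) / (cmod y * cmod v)"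
      using False by (simp add: diff_frac_eq norm_divide norm_mult mult_ac)
    thus ?thesis
      using False norm_pair_factor[of y x] norm_pair_factor[of v u]
      by (simp add: hom_point_def dist_riemann_sphere_def mult_ac)
  qed
qed

section \<open>Limits on the sphere and orthogonal projection onto a line\<close>

lemma continuous_stereographic: "continuous_on UNIV stereographic"
  by (rule continuous_onI)
    (metis chordal_eq_dist_stereographic dist_riemann_sphere_def less_imp_le)

text \<open>Needed for \<open>Lim\<close> in \<open>chordal_deriv\<close> to be determined: points
  such as z + e/4, or 4/e near \<open>Infty\<close>, show that no point is isolated.\<close>

lemma riemann_sphere_at_neq_bot: "at (p :: riemann_sphere) \<noteq> bot"
proof -
  have "\<exists>q. q \<noteq> p \<and> dist q p < e" if e: "e > 0" for e
  proof (cases p)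
    case (Fin z)
    have "sqrt (1 + (cmod (z + of_real (e/4)))\<^sup>2) * sqrt (1 + (cmod z)\<^sup>2) \<ge> 1 * 1"
      by (intro mult_mono) auto
    hence "dist (Fin (z + of_real (e/4))) p \<le> 2 * (e/4) / 1"
      using e unfolding Fin dist_riemann_sphere_def chordal.simps
      by (intro frac_le) auto
    with e Fin show ?thesis by (intro exI[of _ "Fin (z + of_real (e/4))"]) auto
  next
    case Infty
    have "4/e = sqrt ((4/e)\<^sup>2)" using e by simp
    also have "\<dots> \<le> sqrt (1 + (4/e)\<^sup>2)" by (rule real_sqrt_le_mono) simp
    finally have "2 / sqrt (1 + (4/e)\<^sup>2) \<le> 2 / (4/e)"
      using e by (intro frac_le) auto
    also have "\<dots> < e" using e by simp
    finally have "dist (Fin (of_real (4/e))) Infty < e"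
      unfolding dist_riemann_sphere_def chordal.simps norm_of_real power2_abs .
    with Infty show ?thesis by (intro exI[of _ "Fin (of_real (4/e))"]) auto
  qed
  hence "p islimpt UNIV" unfolding islimpt_approachable by auto
  thus ?thesis by (simp add: trivial_limit_within)
qed

text \<open>By Cauchy-Schwarz, |v . (z - w)| / |v| bounds the distance from z to any w in the
  hyperplane from below; the foot of the perpendicular attains it.\<close>

lemma closest_point_hyperplane:
  fixes v z :: "'a :: euclidean_space"
  assumes "v \<noteq> 0"
  shows "closest_point {w. v \<bullet> w = s} z = z - ((v \<bullet> z - s) / (v \<bullet> v)) *\<^sub>R v" (is "_ = ?f")
proof (rule closest_point_unique[symmetric])
  have vv: "v \<bullet> v \<noteq> 0" using assms by simp
  show "?f \<in> {w. v \<bullet> w = s}" using vv by (simp add: inner_diff_right)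
  show "\<forall>w\<in>{w. v \<bullet> w = s}. dist z ?f \<le> dist z w"
  proof safe
    fix w assume s: "s = v \<bullet> w"
    have "\<bar>v \<bullet> (z - w)\<bar> \<le> norm v * norm (z - w)" by (rule Cauchy_Schwarz_ineq2)
    hence "\<bar>v \<bullet> (z - w)\<bar> / norm v \<le> norm (z - w)"
      using assms by (simp add: field_simps)
    thus "dist z (z - ((v \<bullet> z - v \<bullet> w) / (v \<bullet> v)) *\<^sub>R v) \<le> dist z w"
      using assms by (simp add: dist_norm inner_diff_right power2_norm_eq_inner[symmetric] power2_eq_square)
  qed
qed (auto intro: closed_hyperplane convex_hyperplane)

section \<open>The Gram matrix of a matrix of determinant one\<close>

locale unimodular =
  fixes a b c d :: complex
  assumes det: "a * d - b * c = 1"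
begin

text \<open>The entries of the positive Hermitian matrix \<open>A\<^sup>* A\<close>, where \<open>A\<close> has rows \<open>(a, b)\<close> and
  \<open>(c, d)\<close>, and the discriminant of the Hermitian matrix \<open>A\<^sup>* A - 1\<close> whose null vectors form
  the chordal isometric circle.\<close>

definition p :: real where "p = (cmod a)\<^sup>2 + (cmod c)\<^sup>2"
definition t :: real where "t = (cmod b)\<^sup>2 + (cmod d)\<^sup>2"
definition q :: complex where "q = cnj a * b + cnj c * d"
definition k :: real where "k = p + t - 2"

abbreviation g where "g \<equiv> moebius_map a b c d"

lemma of_real_gram:
  "complex_of_real p = a * cnj a + c * cnj c" "complex_of_real t = b * cnj b + d * cnj d"
  by (simp_all add: p_def t_def complex_norm_square del: of_real_power)

lemma norm_image:
  "(cmod (a * x + b * y))\<^sup>2 + (cmod (c * x + d * y))\<^sup>2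
    = p * (cmod x)\<^sup>2 + t * (cmod y)\<^sup>2 + 2 * Re (cnj x * y * q)"
proof -
  have Re: "complex_of_real (2 * Re w) = w + cnj w" for w by (simp add: complex_add_cnj)
  have "complex_of_real ((cmod (a * x + b * y))\<^sup>2 + (cmod (c * x + d * y))\<^sup>2)
    = complex_of_real (p * (cmod x)\<^sup>2 + t * (cmod y)\<^sup>2 + 2 * Re (cnj x * y * q))"
    unfolding of_real_add of_real_mult[of p] of_real_mult[of t] Re complex_norm_square
      of_real_gram q_def
    by (simp add: algebra_simps)
  thus ?thesis unfolding of_real_eq_iff .
qed

text \<open>The determinant of \<open>A\<^sup>* A\<close> is |det A|^2.\<close>

lemma gram_det: "p * t - (cmod q)\<^sup>2 = 1"
proof -
  have "complex_of_real (p * t - (cmod q)\<^sup>2) = (a * d - b * c) * cnj (a * d - b * c)"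
    unfolding of_real_diff of_real_mult of_real_gram complex_norm_square q_def
    by (simp add: algebra_simps)
  thus ?thesis by (simp add: det complex_eq_iff)
qed

text \<open>For a 2 by 2 matrix H of determinant one, det (H - 1) = 2 - tr H; so \<open>k\<close> is
  minus the determinant of \<open>A\<^sup>* A - 1\<close>.\<close>

lemma k_altdef: "k = (cmod q)\<^sup>2 - (p - 1) * (t - 1)"
  using gram_det by (simp add: k_def algebra_simps)

text \<open>Because ad - bc = 1, \<open>k\<close> is the sum of squares |a - cnj d|^2 + |b + cnj
  c|^2.\<close>

lemma k_nonneg: "k \<ge> 0"
proof -
  have cnj_det: "cnj a * cnj d - cnj b * cnj c = 1"
    by (metis det complex_cnj_diff complex_cnj_mult complex_cnj_one)
  have "complex_of_real k = complex_of_real ((cmod (a - cnj d))\<^sup>2 + (cmod (b + cnj c))\<^sup>2)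
     + (a * d - b * c) + (cnj a * cnj d - cnj b * cnj c) - 2"
    unfolding k_def of_real_add of_real_diff of_real_mult of_real_gram complex_norm_square
    by (simp add: algebra_simps)
  also have "\<dots> = complex_of_real ((cmod (a - cnj d))\<^sup>2 + (cmod (b + cnj c))\<^sup>2)"
    unfolding det cnj_det by simp
  finally show ?thesis unfolding of_real_eq_iff by simp
qed

text \<open>Trace two and determinant one force |q|^2 + (p - 1)^2 = 0, so \<open>A\<close> is
  unitary.\<close>

lemma gram_eq_1:
  assumes "k = 0"
  shows "p = 1" "t = 1" "q = 0"
proof -
  have t: "t = 2 - p" using assms by (simp add: k_def)
  have "(cmod q)\<^sup>2 + (p - 1)\<^sup>2 = 0"
    using gram_det by (simp add: t power2_eq_square algebra_simps)
  thus "p = 1" "q = 0" by (simp_all add: add_nonneg_eq_0_iff)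
  thus "t = 1" using t by simp
qed

section \<open>The action of the map on homogeneous vectors\<close>

lemma det_image:
  "(a * x + b * y) * (c * u + d * v) - (c * x + d * y) * (a * u + b * v) = x * v - y * u"
proof -
  have "(a * x + b * y) * (c * u + d * v) - (c * x + d * y) * (a * u + b * v)
    = (a * d - b * c) * (x * v - y * u)" by (simp add: algebra_simps)
  thus ?thesis by (simp add: det)
qed

text \<open>Pairing the image of (x, y) with the images of the two basis vectors recovers x and
  -y.\<close>

lemma image_nonzero:
  assumes "(x, y) \<noteq> 0"
  shows "(a * x + b * y, c * x + d * y) \<noteq> 0"
  using det_image[of x y 0 1] det_image[of x y 1 0] assms by (auto simp: zero_prod_def)

lemma moebius_hom_point:
  assumes "(x, y) \<noteq> 0"
  shows "g (hom_point x y) = hom_point (a * x + b * y) (c * x + d * y)"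
proof (cases "y = 0")
  case True
  thus ?thesis using assms by (simp add: hom_point_def zero_prod_def)
next
  case False
  hence "a * (x / y) + b = (a * x + b * y) / y" "c * (x / y) + d = (c * x + d * y) / y"
    by (simp_all add: field_simps)
  thus ?thesis using False by (simp add: hom_point_def)
qed

lemma dist_moebius:
  assumes "(x, y) \<noteq> 0" "(u, v) \<noteq> 0"
  shows "dist (g (hom_point x y)) (g (hom_point u v)) = 2 * cmod (x * v - y * u) /
    (norm (a * x + b * y, c * x + d * y) * norm (a * u + b * v, c * u + d * v))"
  using assms by (simp add: moebius_hom_point dist_hom_point image_nonzero det_image)

lemma surj_moebius: "surj g"
  unfolding surj_def
proof
  fix s :: riemann_sphere
  obtain x y where s: "s = hom_point x y" "(x, y) \<noteq> 0" by (rule hom_point_cases)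
  \<comment> \<open>The preimage comes from the adjugate of \<open>A\<close>, which is its
    inverse.\<close>
  have id: "a * (d * x - b * y) + b * (a * y - c * x) = (a * d - b * c) * x"
      "c * (d * x - b * y) + d * (a * y - c * x) = (a * d - b * c) * y"
    by (simp_all add: algebra_simps)
  have nz: "(d * x - b * y, a * y - c * x) \<noteq> 0"
    using id s(2) by (auto simp: det zero_prod_def)
  show "\<exists>r. s = g r"
    using moebius_hom_point[OF nz] by (metis id det s(1) mult_1)
qed

lemma chordal_isometry_if_gram_eq_1:
  assumes "k = 0"
  shows "chordal_isometry g"
  unfolding chordal_isometry_def
proof (intro conjI allI surj_moebius)
  fix r s
  obtain x y u v where rs: "r = hom_point x y" "(x, y) \<noteq> 0" "s = hom_point u v" "(u, v) \<noteq> 0"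
    by (metis hom_point_cases)
  have "norm (a * x + b * y, c * x + d * y) = norm (x, y)" for x y
    unfolding norm_Pair norm_image using gram_eq_1[OF assms] by simp
  thus "dist (g r) (g s) = dist r s"
    using rs by (simp add: dist_moebius dist_hom_point)
qed

section \<open>The chordal derivative\<close>

text \<open>In stereographic coordinates, the squared stretching factor \<open>|A Z|\<^sup>2 / |Z|\<^sup>2\<close> of the
  homogeneous vectors is an affine function; hence it is continuous.\<close>

definition stretch :: "complex \<times> real \<Rightarrow> real" where
  "stretch w = p * (1 + snd w) / 2 + t * (1 - snd w) / 2 + q \<bullet> fst w"

text \<open>If (w, h) is the projection of z and Z = (z, 1), then |z|^2 / |Z|^2 = (1 + h)/2, 1 /
  |Z|^2 = (1 - h)/2 and z / |Z|^2 = w/2; substitute these in the Hermitian form.\<close>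

lemma stretch_hom_point:
  assumes "(x, y) \<noteq> 0"
  shows "stretch (stereographic (hom_point x y))
    = (norm (a * x + b * y, c * x + d * y) / norm (x, y))\<^sup>2"
proof (cases "y = 0")
  case True
  hence "x \<noteq> 0" using assms by (simp add: zero_prod_def)
  thus ?thesis using True
    by (simp add: hom_point_def stretch_def p_def norm_Pair power_divide norm_mult
        power_mult_distrib field_simps)
next
  case False
  define z where "z = x / y"
  define N where "N = 1 + (cmod z)\<^sup>2"
  have N: "N > 0" using one_plus_cmod_square_pos by (simp add: N_def)
  have x: "x = z * y" using False by (simp add: z_def)
  have im: "a * x + b * y = (a * z + b * 1) * y" "c * x + d * y = (c * z + d * 1) * y"
    by (simp_all add: x algebra_simps)
  have "(norm (a * x + b * y, c * x + d * y))\<^sup>2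
      = ((cmod (a * z + b * 1))\<^sup>2 + (cmod (c * z + d * 1))\<^sup>2) * (cmod y)\<^sup>2"
    unfolding norm_Pair im norm_mult power_mult_distrib by (simp add: algebra_simps)
  hence "(norm (a * x + b * y, c * x + d * y))\<^sup>2 = (p * (N - 1) + t + 2 * (q \<bullet> z)) * (cmod y)\<^sup>2"
    unfolding norm_image by (simp add: N_def inner_complex_def algebra_simps)
  moreover have "(norm (x, y))\<^sup>2 = N * (cmod y)\<^sup>2"
    by (simp add: norm_Pair N_def x norm_mult power_mult_distrib algebra_simps)
  ultimately have "(norm (a * x + b * y, c * x + d * y) / norm (x, y))\<^sup>2
      = (p * (N - 1) + t + 2 * (q \<bullet> z)) / N"
    using False by (simp add: power_divide)
  moreover have cz: "(cmod z)\<^sup>2 = N - 1" by (simp add: N_def)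
  have "stretch (stereographic (Fin z)) = (p * (N - 1) + t + 2 * (q \<bullet> z)) / N"
    using N by (simp add: stretch_def cz field_simps)
  ultimately show ?thesis using False by (simp add: hom_point_def z_def)
qed

text \<open>The difference quotient equals 1 / (sqrt (F s) sqrt (F r)) exactly, with F the stretch,
  so continuity of F alone gives the limit.\<close>

lemma chordal_deriv_moebius: "chordal_deriv g r = 1 / stretch (stereographic r)"
proof -
  let ?F = "\<lambda>s. stretch (stereographic s)"
  have pos: "?F s > 0" for s
  proof -
    obtain x y where s: "s = hom_point x y" "(x, y) \<noteq> 0" by (rule hom_point_cases)
    show ?thesis unfolding s(1) stretch_hom_point[OF s(2)]
      using s(2) image_nonzero[OF s(2)] by simp
  qed
  have quot: "dist (g s) (g r) / dist s r = 1 / (sqrt (?F s) * sqrt (?F r))" if "s \<noteq> r" for s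
  proof -
    obtain x y u v where rs: "s = hom_point x y" "(x, y) \<noteq> 0" "r = hom_point u v" "(u, v) \<noteq> 0"
      by (metis hom_point_cases)
    have "x * v - y * u \<noteq> 0" using dist_hom_point[OF rs(2,4)] that rs(1,3) by auto
    thus ?thesis
      unfolding rs(1,3)
        dist_moebius[OF rs(2,4)] dist_hom_point[OF rs(2,4)]
        stretch_hom_point[OF rs(2)] stretch_hom_point[OF rs(4)]
      using rs(2,4) by (simp add: real_sqrt_unique field_simps del: power_divide)
  qed
  have "isCont stereographic r"
    using continuous_stereographic by (simp add: continuous_on_eq_continuous_at)
  hence st: "(stereographic \<longlongrightarrow> stereographic r) (at r)" by (simp add: isCont_def)
  have lim: "(?F \<longlongrightarrow> ?F r) (at r)" unfolding stretch_def by (intro tendsto_intros st) auto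
  have "((\<lambda>s. 1 / (sqrt (?F s) * sqrt (?F r))) \<longlongrightarrow> 1 / (sqrt (?F r) * sqrt (?F r))) (at r)"
    using pos[of r] by (intro tendsto_intros lim) auto
  moreover have "\<forall>\<^sub>F s in at r. 1 / (sqrt (?F s) * sqrt (?F r)) = dist (g s) (g r) / dist s r"
    using quot by (simp add: eventually_at_filter)
  ultimately have "((\<lambda>s. dist (g s) (g r) / dist s r) \<longlongrightarrow> 1 / (sqrt (?F r) * sqrt (?F r))) (at r)"
    by (rule Lim_transform_eventually)
  thus ?thesis
    unfolding chordal_deriv_def
    using tendsto_Lim[OF riemann_sphere_at_neq_bot] pos[of r] by (simp add: less_imp_le)
qed

text \<open>Stretch one, cleared of the denominator 1 + |z|^2, says that the form of
  \<open>A\<^sup>* A - 1\<close> vanishes at (z, 1).\<close>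

lemma Fin_in_circle_iff:
  "Fin z \<in> chordal_isometric_circle g \<longleftrightarrow> (p - 1) * (cmod z)\<^sup>2 + 2 * (q \<bullet> z) + (t - 1) = 0"
proof -
  define N where "N = 1 + (cmod z)\<^sup>2"
  have N: "N > 0" using one_plus_cmod_square_pos by (simp add: N_def)
  have cz: "(cmod z)\<^sup>2 = N - 1" by (simp add: N_def)
  have "stretch (stereographic (Fin z)) = 1 + ((p - 1) * (N - 1) + 2 * (q \<bullet> z) + (t - 1)) / N"
    using N by (simp add: stretch_def cz field_simps)
  moreover have "1 / u = 1 \<longleftrightarrow> u = 1" for u :: real by auto
  ultimately show ?thesis using N
    by (simp add: chordal_isometric_circle_def chordal_deriv_moebius cz del: stereographic.simps)
qed

lemma Infty_in_circle_iff: "Infty \<in> chordal_isometric_circle g \<longleftrightarrow> p = 1"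
  by (auto simp: chordal_isometric_circle_def chordal_deriv_moebius stretch_def)

section \<open>The reflection in homogeneous coordinates\<close>

text \<open>The polarised equation \<open>(p - 1) w z\<^sup>* + q\<^sup>* w + q z\<^sup>* + (t - 1) = 0\<close> of the chordal isometric
  circle, solved for \<open>w\<close> in homogeneous coordinates, gives the reflection in either case.\<close>

definition refl1 :: "complex \<Rightarrow> complex \<Rightarrow> complex" where
  "refl1 x y = - (q * cnj x + of_real (t - 1) * cnj y)"

definition refl2 :: "complex \<Rightarrow> complex \<Rightarrow> complex" where
  "refl2 x y = of_real (p - 1) * cnj x + cnj q * cnj y"

lemma of_real_k: "complex_of_real k = q * cnj q - of_real (p - 1) * of_real (t - 1)"
  unfolding k_altdef of_real_diff[of "(cmod q)\<^sup>2"] of_real_mult complex_norm_square ..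

text \<open>The matrix \<open>B\<close> has determinant \<open>-k\<close>.\<close>

lemma refl_det:
  "refl1 x y * refl2 u v - refl2 x y * refl1 u v = - of_real k * cnj (x * v - y * u)"
  unfolding of_real_k refl1_def refl2_def by (simp add: algebra_simps)

text \<open>\<open>B\<close> times its entrywise conjugate is the scalar \<open>k\<close>;
  projectively the map is an involution.\<close>

lemma refl_refl:
  "refl1 (refl1 x y) (refl2 x y) = of_real k * x" "refl2 (refl1 x y) (refl2 x y) = of_real k * y"
  unfolding of_real_k refl1_def refl2_def by (simp_all add: algebra_simps)

text \<open>Let H = \<open>A\<^sup>* A\<close> and let J be the quarter turn. Then B = J cnj (H -
  1), and det H = 1 turns the form H in B into the conjugate of H - 2 + 1/H, which is the scalar
  \<open>k\<close> by Cayley-Hamilton.\<close>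

lemma norm_image_refl:
  "norm (a * refl1 x y + b * refl2 x y, c * refl1 x y + d * refl2 x y) = sqrt k * norm (x, y)"
proof -
  define P T where "P = complex_of_real p" and "T = complex_of_real t"
  have rel: "P * T = 1 + q * cnj q"
  proof -
    have "p * t = 1 + (cmod q)\<^sup>2" using gram_det by simp
    hence "complex_of_real (p * t) = complex_of_real (1 + (cmod q)\<^sup>2)" by (simp only:)
    thus ?thesis unfolding P_def T_def of_real_mult of_real_add complex_norm_square by simp
  qed
  have Re2: "complex_of_real (2 * Re w) = w + cnj w" for w by (simp add: complex_add_cnj)
  have r: "refl1 x y = - (q * cnj x + (T - 1) * cnj y)" "refl2 x y = (P - 1) * cnj x + cnj q * cnj y"
    "cnj (refl1 x y) = - (cnj q * x + (T - 1) * y)" "cnj (refl2 x y) = (P - 1) * x + q * y"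
    by (simp_all add: refl1_def refl2_def P_def T_def)
  have k: "complex_of_real k = P + T - 2" by (simp add: k_def P_def T_def)
  have "complex_of_real (p * (cmod (refl1 x y))\<^sup>2 + t * (cmod (refl2 x y))\<^sup>2
      + 2 * Re (cnj (refl1 x y) * refl2 x y * q)) = complex_of_real (k * ((cmod x)\<^sup>2 + (cmod y)\<^sup>2))"
    unfolding of_real_add of_real_mult[of k] of_real_mult[of p] of_real_mult[of t] Re2
      complex_norm_square k P_def[symmetric] T_def[symmetric] complex_cnj_mult complex_cnj_cnj
    \<comment> \<open>Conjugates are expanded first; afterwards the variables and their conjugates
      act as independent unknowns tied only by \<open>rel\<close>.\<close>
    unfolding r(3,4) unfolding r(1,2)
    using rel by algebra
  hence "(cmod (a * refl1 x y + b * refl2 x y))\<^sup>2 + (cmod (c * refl1 x y + d * refl2 x y))\<^sup>2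
      = k * ((cmod x)\<^sup>2 + (cmod y)\<^sup>2)"
    unfolding norm_image of_real_eq_iff .
  thus ?thesis by (simp add: norm_Pair real_sqrt_mult)
qed

section \<open>The circle and line cases\<close>

text \<open>The set is a line exactly when \<open>p = 1\<close>. Positivity of \<open>k\<close>
  rules out degeneracy: it makes the normal \<open>q\<close> of the line nonzero and the radius of
  the circle positive.\<close>

lemma ex_reflection:
  assumes k: "k > 0"
  obtains R where "is_reflection_across (chordal_isometric_circle g) R"
    "\<And>x y. (x, y) \<noteq> 0 \<Longrightarrow> R (hom_point x y) = hom_point (refl1 x y) (refl2 x y)"
proof (cases "p = 1")
  case True
  define L where "L = {z. q \<bullet> z = (1 - t) / 2}"
  have "(cmod q)\<^sup>2 = k" using True by (simp add: k_altdef)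
  hence q: "q \<noteq> 0" using k by auto
  have "s \<in> chordal_isometric_circle g \<longleftrightarrow> s \<in> insert Infty (Fin ` L)" for s
    using True by (cases s) (auto simp: Fin_in_circle_iff Infty_in_circle_iff L_def field_simps)
  moreover have "affine L" "aff_dim L = 1"
    using aff_dim_hyperplane[OF q, of "(1 - t) / 2"] affine_hyperplane[of q "(1 - t) / 2"]
    by (simp_all add: L_def)
  ultimately have "is_reflection_across (chordal_isometric_circle g) (line_reflection L)"
    unfolding is_reflection_across_def by blast
  moreover have "line_reflection L (hom_point x y) = hom_point (refl1 x y) (refl2 x y)"
    if nz: "(x, y) \<noteq> 0" for x y
  proof (cases "y = 0")
    case True
    thus ?thesis using \<open>p = 1\<close> by (simp add: hom_point_def refl2_def)
  next
    case False
    define z where "z = x / y"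
    have x: "cnj x = cnj z * cnj y" using False by (simp add: z_def)
    have inn: "q * cnj z + cnj q * z = of_real (2 * (q \<bullet> z))"
      using complex_add_cnj[of "q * cnj z"] by (simp add: inner_complex_def)
    have "2 * closest_point L z - z = z - of_real ((2 * (q \<bullet> z) - (1 - t)) / (q \<bullet> q)) * q"
      unfolding L_def closest_point_hyperplane[OF q] using q
      by (simp add: scaleR_conv_of_real field_simps)
    also have "\<dots> = z - (of_real (2 * (q \<bullet> z)) - (1 - of_real t)) / (q * cnj q) * q"
      by (simp add: complex_norm_square[symmetric] power2_norm_eq_inner[symmetric])
    also have "\<dots> = - (q * cnj z + of_real (t - 1)) / cnj q"
      unfolding inn[symmetric] using q by (simp add: field_simps)
    also have "\<dots> = refl1 x y / refl2 x y"
      using False q \<open>p = 1\<close> unfolding refl1_def refl2_def x by (simp add: field_simps)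
    finally show ?thesis
      using False q \<open>p = 1\<close> by (simp add: hom_point_def z_def refl2_def)
  qed
  ultimately show ?thesis by (rule that)
next
  case False
  \<comment> \<open>Centre and radius come from completing the square; \<open>p - 1\<close> may be
    negative, hence the absolute value.\<close>
  define z0 where "z0 = - q / of_real (p - 1)"
  define r where "r = sqrt k / \<bar>p - 1\<bar>"
  have r: "r > 0" "r\<^sup>2 = k / (p - 1)\<^sup>2"
    using False k by (simp_all add: r_def power_divide)
  have p1: "complex_of_real (p - 1) \<noteq> 0" using False by (simp del: of_real_diff)
  have q: "q = - (of_real (p - 1) * z0)" using p1 by (simp add: z0_def del: of_real_diff)
  have dist2: "(p - 1) * ((cmod (z - z0))\<^sup>2 - r\<^sup>2) = (p - 1) * (cmod z)\<^sup>2 + 2 * (q \<bullet> z) + (t - 1)" for z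
  proof -
    have "(cmod q)\<^sup>2 = (p - 1)\<^sup>2 * (cmod z0)\<^sup>2"
      unfolding q by (simp add: norm_mult power_mult_distrib del: of_real_diff)
    hence "k = (p - 1) * ((p - 1) * (cmod z0)\<^sup>2 - (t - 1))"
      by (simp add: k_altdef power2_eq_square algebra_simps)
    hence "k / (p - 1) = (p - 1) * (cmod z0)\<^sup>2 - (t - 1)" using False by simp
    moreover have "(p - 1) * r\<^sup>2 = k / (p - 1)" unfolding r(2) by (simp add: power2_eq_square)
    ultimately have "(p - 1) * r\<^sup>2 = (p - 1) * (cmod z0)\<^sup>2 - (t - 1)" by (simp only:)
    moreover have "q \<bullet> z = - (p - 1) * (z \<bullet> z0)"
      unfolding q by (simp add: inner_complex_def algebra_simps)
    moreover have "(cmod (z - z0))\<^sup>2 = (cmod z)\<^sup>2 - 2 * (z \<bullet> z0) + (cmod z0)\<^sup>2"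
      by (simp add: power2_norm_eq_inner inner_diff inner_commute algebra_simps)
    ultimately show ?thesis by algebra
  qed
  have "z \<in> sphere z0 r \<longleftrightarrow> Fin z \<in> chordal_isometric_circle g" for z
  proof -
    have "z \<in> sphere z0 r \<longleftrightarrow> (cmod (z - z0))\<^sup>2 = r\<^sup>2"
      using r(1) by (simp add: dist_norm norm_minus_commute power2_eq_iff_nonneg)
    thus ?thesis using False unfolding Fin_in_circle_iff dist2[symmetric] by simp
  qed
  hence "s \<in> chordal_isometric_circle g \<longleftrightarrow> s \<in> Fin ` sphere z0 r" for s
    using False by (cases s) (auto simp: Infty_in_circle_iff simp del: mem_sphere)
  hence "is_reflection_across (chordal_isometric_circle g) (circle_inversion z0 r)"
    unfolding is_reflection_across_def using r(1) by blast
  moreover have "circle_inversion z0 r (hom_point x y) = hom_point (refl1 x y) (refl2 x y)"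
    if nz: "(x, y) \<noteq> 0" for x y
  proof (cases "y = 0")
    case True
    thus ?thesis using nz p1
      by (simp add: hom_point_def refl1_def refl2_def zero_prod_def z0_def del: of_real_diff)
  next
    case y: False
    define z where "z = x / y"
    define P1 where "P1 = complex_of_real (p - 1)"
    have P1: "P1 \<noteq> 0" "cnj P1 = P1" using p1 by (simp_all add: P1_def del: of_real_diff)
    have x: "cnj x = cnj z * cnj y" using y by (simp add: z_def)
    have q': "q = - (P1 * z0)" using q by (simp add: P1_def)
    have r2: "refl2 x y = P1 * (cnj z - cnj z0) * cnj y"
      unfolding refl2_def x q' by (simp add: P1 P1_def[symmetric] algebra_simps del: of_real_diff)
    \<comment> \<open>So both descriptions send exactly the centre to \<open>Infty\<close>.\<close>
    have r2_0: "refl2 x y = 0 \<longleftrightarrow> z = z0" using y P1 by (simp add: r2)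
    have "z0 + of_real (r\<^sup>2) / (cnj z - cnj z0) = refl1 x y / refl2 x y" if "z \<noteq> z0"
    proof -
      have nz: "cnj z - cnj z0 \<noteq> 0" using that by simp
      have "complex_of_real (r\<^sup>2) = (P1 * z0 * (P1 * cnj z0) - P1 * of_real (t - 1)) / P1\<^sup>2"
        unfolding r(2) of_real_divide of_real_k of_real_power P1_def[symmetric] q' by (simp add: P1)
      also have "\<dots> = (P1 * (P1 * (z0 * cnj z0) - of_real (t - 1))) / (P1 * P1)"
        by (simp add: power2_eq_square algebra_simps del: of_real_diff)
      also have "\<dots> = z0 * cnj z0 - of_real (t - 1) / P1"
        using P1 by (simp add: diff_divide_distrib del: of_real_diff)
      finally have "complex_of_real (r\<^sup>2) = z0 * cnj z0 - of_real (t - 1) / P1" .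
      hence "z0 + of_real (r\<^sup>2) / (cnj z - cnj z0)
          = (P1 * z0 * cnj z - of_real (t - 1)) / (P1 * (cnj z - cnj z0))"
        using nz P1 by (simp add: divide_simps del: of_real_diff of_real_power)
           (simp add: algebra_simps)
      also have "\<dots> = refl1 x y / refl2 x y"
        unfolding r2 unfolding refl1_def x q' using y by (simp add: algebra_simps divide_simps)
      finally show ?thesis .
    qed
    thus ?thesis using y r2_0 by (simp add: hom_point_def z_def)
  qed
  ultimately show ?thesis by (rule that)
qed

end

section \<open>The decomposition\<close>

theorem theorem2p2:
  fixes a b c d :: complex
  assumes "a * d - b * c = 1"
    and "\<not> chordal_isometry (moebius_map a b c d)"
  shows "\<exists>R S. is_reflection_across (chordal_isometric_circle (moebius_map a b c d)) R \<and>
    chordal_isometry S \<and> moebius_map a b c d = S \<circ> R"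
proof -
  interpret unimodular a b c d by standard (rule assms)
  have k: "k > 0" using k_nonneg chordal_isometry_if_gram_eq_1 assms(2) by fastforce
  obtain R where R: "is_reflection_across (chordal_isometric_circle g) R"
    and R_hom: "\<And>x y. (x, y) \<noteq> 0 \<Longrightarrow> R (hom_point x y) = hom_point (refl1 x y) (refl2 x y)"
    using ex_reflection[OF k] by blast
  \<comment> \<open>A zero vector would have image of norm zero under \<open>A\<close>, against the
    norm formula with \<open>k > 0\<close>.\<close>
  have refl_nz: "(refl1 x y, refl2 x y) \<noteq> 0" if "(x, y) \<noteq> 0" for x y
    using norm_image_refl[of x y] that k by (auto simp: zero_prod_def)
  have RR: "R (R s) = s" for s
  proof -
    obtain x y where s: "s = hom_point x y" "(x, y) \<noteq> 0" by (rule hom_point_cases)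
    have "hom_point (of_real k * x) (of_real k * y) = hom_point x y"
      using k by (simp add: hom_point_def)
    thus ?thesis using s refl_nz[OF s(2)] by (simp add: R_hom refl_refl)
  qed
  have "dist (g (R r)) (g (R s)) = dist r s" for r s
  proof -
    obtain x y u v where rs: "r = hom_point x y" "(x, y) \<noteq> 0" "s = hom_point u v" "(u, v) \<noteq> 0"
      by (metis hom_point_cases)
    have det: "cmod (refl1 x y * refl2 u v - refl2 x y * refl1 u v) = k * cmod (x * v - y * u)"
      unfolding refl_det using k by (simp add: norm_mult del: complex_cnj_mult complex_cnj_diff)
    have "dist (g (R r)) (g (R s))
        = 2 * (k * cmod (x * v - y * u)) / (sqrt k * norm (x, y) * (sqrt k * norm (u, v)))"
      unfolding rs(1,3) R_hom[OF rs(2)] R_hom[OF rs(4)] dist_moebius[OF refl_nz[OF rs(2)] refl_nz[OF rs(4)]]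
        det norm_image_refl ..
    \<comment> \<open>One factor \<open>sqrt k\<close> from each norm cancels the factor
      \<open>k\<close> of the determinant.\<close>
    also have "sqrt k * norm (x, y) * (sqrt k * norm (u, v)) = k * (norm (x, y) * norm (u, v))"
      using k by simp
    finally show ?thesis
      using k by (simp add: rs(1,3) dist_hom_point[OF rs(2,4)])
  qed
  moreover have "surj (g \<circ> R)"
    using surj_moebius RR by (intro comp_surj surjI[of R R]) auto
  ultimately have "chordal_isometry (g \<circ> R)" by (simp add: chordal_isometry_def)
  moreover have "g = g \<circ> R \<circ> R" by (simp add: fun_eq_iff RR)
  ultimately show ?thesis using R by blast
qed

end
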